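(* For any set $\mathcal H$ of formulas and any formula $Q$: if $\mathcal H\vdash Q$ in QPL then $\mathcal H\models Q$, where the semantic yield $\models$ is taken with respect to $S=\mathcal H\cup\{Q\}$.
   Context: Language: first-order, no equality, no function symbols of positive arity; terms are variables and constants; atomic formulas $\top,\bot,R(t_1,\dots,t_j)$; formulas built by $\land,\lor,\to,\forall x,\exists x$; $A(t)$ is substitution of substitutable $t$ for free $x$. QPL is the Hilbert-style calculus with rules (premises / conclusion): axioms $\top$ and $A\to A$; $A,B/A\land B$; $A\land B/A$, $A\land B/B$; $A/A\lor B$, $B/A\lor B$; $A\lor A/A$; $B/A\to B$; $A,A\to B/B$; $\bot/A$; $A/\forall xA$ ($x$ not free in $A$); $\forall xA(x)/A(t)$; $A(t)/\exists xA(x)$; $\exists xA/A$ ($x$ not free in $A$). $\mathcal H\vdash Q$ means there is a finite derivation tree of $Q$ whose leaves are axioms or members of $\mathcal H$. Parameters of a formula: constants occurring and variables free in it. Fix a constant; $\mathrm{Pars}^*(S)$ is the set of parameters of formulas of $S$, plus the fixed constant if that set has no constant. Subformulas: $A$; components of binary-connective subformulas; $B(t)$ for any substitutable term $t$ if $\forall xB(x)$ or $\exists xB(x)$ is a subformula. The closure $\overline S$ = the $\mathrm{Pars}^*(S)$-formulas (all parameters in $\mathrm{Pars}^*(S)$) that are subformulas of formulas in $S$. Let $P=\mathrm{Pars}^*(S)$. A standard structure for $S$ is a first-order structure with universe $P$, whose individual constants are exactly the elements $p\in P$ (free variables included), each interpreted as itself, and whose relation symbols are exactly those occurring in $S$.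 An override function $O$ for $S$ assigns a value in $\{\top,\bot\}$ to each formula of $\overline S$ of the form $A\lor B$ or $A\to B$ with $A\ne B$, or $\forall xA(x)$ or $\exists xA(x)$ where $x$ occurs free in $A(x)$. For $X\in\overline S$, $M\models_O X$ is defined by induction: atomic $X$: $M$ satisfies $X$ classically ($\top$ holds, $\bot$ fails); $M\models_O A\land B$ iff both; $M\models_O A\lor A$ iff $M\models_O A$, and for $A\ne B$, $M\models_O A\lor B$ iff $M\models_O A$ or $M\models_O B$ or $O(A\lor B)=\top$; $M\models_O A\to A$ always, and for $A\ne B$, $M\models_O A\to B$ iff $M\models_O B$ or ($M\not\models_O A$ and $O(A\to B)=\top$); if $x$ is not free in $A$, $M\models_O \forall xA$ iff $M\models_O A$, and otherwise $M\models_O\forall xA(x)$ iff $M\models_O A(t)$ for all $t\in P$ and $O(\forall xA(x))=\top$; if $x$ is not free in $A$, $M\models_O\exists xA$ iff $M\models_O A$, otherwise $M\models_O \exists xA(x)$ iff $M\models_O A(p)$ for some $p\in P$ or $O(\exists xA(x))=\top$. $\mathcal H\models X$ means: for every standard structure $M$ for $S$ and every override function $O$ for $S$, if $M\models_O Y$ for all $Y\in\mathcal H$ then $M\models_O X$. *)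

theory Defs
  imports Main "HOL-Library.FuncSet"
begin

datatype 'c trm = Var nat | Con 'c

datatype ('r, 'c) fm =
    Top
  | Bot
  | Rel 'r "'c trm list"
  | Conj "('r, 'c) fm" "('r, 'c) fm"
  | Disj "('r, 'c) fm" "('r, 'c) fm"
  | Imp "('r, 'c) fm" "('r, 'c) fm"
  | All nat "('r, 'c) fm"
  | Ex nat "('r, 'c) fm"

text \<open>The formulas of the language whose relation symbols have the arities \<open>ar\<close>.\<close>

primrec is_formula :: "('r \<Rightarrow> nat) \<Rightarrow> ('r, 'c) fm \<Rightarrow> bool" where
  "is_formula ar Top = True"
| "is_formula ar Bot = True"
| "is_formula ar (Rel R ts) = (length ts = ar R)"
| "is_formula ar (Conj A B) = (is_formula ar A \<and> is_formula ar B)"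
| "is_formula ar (Disj A B) = (is_formula ar A \<and> is_formula ar B)"
| "is_formula ar (Imp A B) = (is_formula ar A \<and> is_formula ar B)"
| "is_formula ar (All x A) = is_formula ar A"
| "is_formula ar (Ex x A) = is_formula ar A"

primrec fv :: "('r, 'c) fm \<Rightarrow> nat set" where
  "fv Top = {}"
| "fv Bot = {}"
| "fv (Rel R ts) = {x. Var x \<in> set ts}"
| "fv (Conj A B) = fv A \<union> fv B"
| "fv (Disj A B) = fv A \<union> fv B"
| "fv (Imp A B) = fv A \<union> fv B"
| "fv (All x A) = fv A - {x}"
| "fv (Ex x A) = fv A - {x}"

primrec consts_of :: "('r, 'c) fm \<Rightarrow> 'c set" where
  "consts_of Top = {}"
| "consts_of Bot = {}"
| "consts_of (Rel R ts) = {c. Con c \<in> set ts}"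
| "consts_of (Conj A B) = consts_of A \<union> consts_of B"
| "consts_of (Disj A B) = consts_of A \<union> consts_of B"
| "consts_of (Imp A B) = consts_of A \<union> consts_of B"
| "consts_of (All x A) = consts_of A"
| "consts_of (Ex x A) = consts_of A"

primrec rels_of :: "('r, 'c) fm \<Rightarrow> 'r set" where
  "rels_of Top = {}"
| "rels_of Bot = {}"
| "rels_of (Rel R ts) = {R}"
| "rels_of (Conj A B) = rels_of A \<union> rels_of B"
| "rels_of (Disj A B) = rels_of A \<union> rels_of B"
| "rels_of (Imp A B) = rels_of A \<union> rels_of B"
| "rels_of (All x A) = rels_of A"
| "rels_of (Ex x A) = rels_of A"

text \<open>\<open>subst x t A\<close> replaces the free occurrences of \<open>x\<close> in \<open>A\<close> by \<open>t\<close>. Bound variables are not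
  renamed, so it is only applied under the side condition \<open>substable x t A\<close>: no free occurrence
  of \<open>x\<close> lies in the scope of a quantifier that would capture \<open>t\<close>.\<close>

primrec subst :: "nat \<Rightarrow> 'c trm \<Rightarrow> ('r, 'c) fm \<Rightarrow> ('r, 'c) fm" where
  "subst x t Top = Top"
| "subst x t Bot = Bot"
| "subst x t (Rel R ts) = Rel R (map (\<lambda>s. if s = Var x then t else s) ts)"
| "subst x t (Conj A B) = Conj (subst x t A) (subst x t B)"
| "subst x t (Disj A B) = Disj (subst x t A) (subst x t B)"
| "subst x t (Imp A B) = Imp (subst x t A) (subst x t B)"
| "subst x t (All y A) = All y (if y = x then A else subst x t A)"
| "subst x t (Ex y A) = Ex y (if y = x then A else subst x t A)"

primrec substable :: "nat \<Rightarrow> 'c trm \<Rightarrow> ('r, 'c) fm \<Rightarrow> bool" where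
  "substable x t Top = True"
| "substable x t Bot = True"
| "substable x t (Rel R ts) = True"
| "substable x t (Conj A B) = (substable x t A \<and> substable x t B)"
| "substable x t (Disj A B) = (substable x t A \<and> substable x t B)"
| "substable x t (Imp A B) = (substable x t A \<and> substable x t B)"
| "substable x t (All y A) = (x \<notin> fv (All y A) \<or> t \<noteq> Var y \<and> substable x t A)"
| "substable x t (Ex y A) = (x \<notin> fv (Ex y A) \<or> t \<noteq> Var y \<and> substable x t A)"

inductive QPL :: "('r \<Rightarrow> nat) \<Rightarrow> ('r, 'c) fm set \<Rightarrow> ('r, 'c) fm \<Rightarrow> bool"
  for ar :: "'r \<Rightarrow> nat" and H :: "('r, 'c) fm set" where
  hyp: "A \<in> H \<Longrightarrow> QPL ar H A"
| top: "QPL ar H Top"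
| refl: "is_formula ar A \<Longrightarrow> QPL ar H (Imp A A)"
| conjI: "QPL ar H A \<Longrightarrow> QPL ar H B \<Longrightarrow> QPL ar H (Conj A B)"
| conjE1: "QPL ar H (Conj A B) \<Longrightarrow> QPL ar H A"
| conjE2: "QPL ar H (Conj A B) \<Longrightarrow> QPL ar H B"
| disjI1: "QPL ar H A \<Longrightarrow> is_formula ar B \<Longrightarrow> QPL ar H (Disj A B)"
| disjI2: "QPL ar H B \<Longrightarrow> is_formula ar A \<Longrightarrow> QPL ar H (Disj A B)"
| disjE: "QPL ar H (Disj A A) \<Longrightarrow> QPL ar H A"
| impI: "QPL ar H B \<Longrightarrow> is_formula ar A \<Longrightarrow> QPL ar H (Imp A B)"
| impE: "QPL ar H A \<Longrightarrow> QPL ar H (Imp A B) \<Longrightarrow> QPL ar H B"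
| botE: "QPL ar H Bot \<Longrightarrow> is_formula ar A \<Longrightarrow> QPL ar H A"
| allI: "QPL ar H A \<Longrightarrow> x \<notin> fv A \<Longrightarrow> QPL ar H (All x A)"
| allE: "QPL ar H (All x A) \<Longrightarrow> substable x t A \<Longrightarrow> QPL ar H (subst x t A)"
| exI: "QPL ar H (subst x t A) \<Longrightarrow> substable x t A \<Longrightarrow> QPL ar H (Ex x A)"
| exE: "QPL ar H (Ex x A) \<Longrightarrow> x \<notin> fv A \<Longrightarrow> QPL ar H A"

definition params :: "('r, 'c) fm \<Rightarrow> 'c trm set" where
  "params A = Var ` fv A \<union> Con ` consts_of A"

definition pars_star :: "'c \<Rightarrow> ('r, 'c) fm set \<Rightarrow> 'c trm set" where
  "pars_star c0 S =
     (let P = (\<Union>A\<in>S. params A) in if \<exists>c. Con c \<in> P then P else insert (Con c0) P)"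

inductive_set subformulas :: "('r, 'c) fm \<Rightarrow> ('r, 'c) fm set" for A :: "('r, 'c) fm" where
  self: "A \<in> subformulas A"
| conj1: "Conj B C \<in> subformulas A \<Longrightarrow> B \<in> subformulas A"
| conj2: "Conj B C \<in> subformulas A \<Longrightarrow> C \<in> subformulas A"
| disj1: "Disj B C \<in> subformulas A \<Longrightarrow> B \<in> subformulas A"
| disj2: "Disj B C \<in> subformulas A \<Longrightarrow> C \<in> subformulas A"
| imp1: "Imp B C \<in> subformulas A \<Longrightarrow> B \<in> subformulas A"
| imp2: "Imp B C \<in> subformulas A \<Longrightarrow> C \<in> subformulas A"
| all: "All x B \<in> subformulas A \<Longrightarrow> substable x t B \<Longrightarrow> subst x t B \<in> subformulas A"
| ex: "Ex x B \<in> subformulas A \<Longrightarrow> substable x t B \<Longrightarrow> subst x t B \<in> subformulas A"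

definition fm_closure :: "'c \<Rightarrow> ('r, 'c) fm set \<Rightarrow> ('r, 'c) fm set" where
  "fm_closure c0 S = {X \<in> (\<Union>A\<in>S. subformulas A). params X \<subseteq> pars_star c0 S}"

text \<open>In a standard structure the parameters, free variables included, play the role of the
  individual constants; hence \<open>icon\<close> is indexed by terms.\<close>

record ('r, 'c) struct =
  univ :: "'c trm set"
  icon :: "'c trm \<Rightarrow> 'c trm"
  irel :: "'r \<Rightarrow> 'c trm list set"

definition standard_structure ::
    "('r \<Rightarrow> nat) \<Rightarrow> 'c \<Rightarrow> ('r, 'c) fm set \<Rightarrow> ('r, 'c) struct \<Rightarrow> bool" where
  "standard_structure ar c0 S M \<longleftrightarrow>
     univ M = pars_star c0 S \<and>
     icon M = (\<lambda>p\<in>pars_star c0 S. p) \<and>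
     irel M \<in> (\<Pi>\<^sub>E R\<in>(\<Union>A\<in>S. rels_of A). {r. \<forall>ts\<in>r. length ts = ar R \<and> set ts \<subseteq> univ M})"

definition overridable :: "'c \<Rightarrow> ('r, 'c) fm set \<Rightarrow> ('r, 'c) fm set" where
  "overridable c0 S = {X \<in> fm_closure c0 S.
     (\<exists>A B. A \<noteq> B \<and> (X = Disj A B \<or> X = Imp A B)) \<or>
     (\<exists>x A. x \<in> fv A \<and> (X = All x A \<or> X = Ex x A))}"

definition override_function ::
    "'c \<Rightarrow> ('r, 'c) fm set \<Rightarrow> (('r, 'c) fm \<Rightarrow> bool) \<Rightarrow> bool" where
  "override_function c0 S ov \<longleftrightarrow> ov \<in> overridable c0 S \<rightarrow>\<^sub>E UNIV"

primrec depth :: "('r, 'c) fm \<Rightarrow> nat" where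
  "depth Top = 0"
| "depth Bot = 0"
| "depth (Rel R ts) = 0"
| "depth (Conj A B) = Suc (max (depth A) (depth B))"
| "depth (Disj A B) = Suc (max (depth A) (depth B))"
| "depth (Imp A B) = Suc (max (depth A) (depth B))"
| "depth (All x A) = Suc (depth A)"
| "depth (Ex x A) = Suc (depth A)"

lemma depth_subst [simp]: "depth (subst x t A) = depth A"
  by (induction A) auto

text \<open>Satisfaction \<open>M \<Turnstile>\<^sub>O X\<close>. It is meaningful for \<open>X\<close> in the closure only; there the recursion
  stays in the closure, so neither the extensional default values of \<open>M\<close> and \<open>ov\<close> nor a bound
  variable is ever consulted. As everywhere, \<open>A(t)\<close> presupposes that \<open>t\<close> is substitutable; a
  variable in the universe may fail to be.\<close>

function sat :: "('r, 'c) struct \<Rightarrow> (('r, 'c) fm \<Rightarrow> bool) \<Rightarrow> ('r, 'c) fm \<Rightarrow> bool" where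
  "sat M ov Top = True"
| "sat M ov Bot = False"
| "sat M ov (Rel R ts) = (map (icon M) ts \<in> irel M R)"
| "sat M ov (Conj A B) = (sat M ov A \<and> sat M ov B)"
| "sat M ov (Disj A B) =
     (if A = B then sat M ov A
      else sat M ov A \<or> sat M ov B \<or> ov (Disj A B))"
| "sat M ov (Imp A B) =
     (if A = B then True
      else sat M ov B \<or> (\<not> sat M ov A \<and> ov (Imp A B)))"
| "sat M ov (All x A) =
     (if x \<notin> fv A then sat M ov A
      else (\<forall>t\<in>univ M. substable x t A \<longrightarrow> sat M ov (subst x t A)) \<and> ov (All x A))"
| "sat M ov (Ex x A) =
     (if x \<notin> fv A then sat M ov A
      else (\<exists>t\<in>univ M. substable x t A \<and> sat M ov (subst x t A)) \<or> ov (Ex x A))"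
  by pat_completeness auto
termination
  by (relation "measure (\<lambda>(M, ov, X). depth X)") auto

definition yields ::
    "('r \<Rightarrow> nat) \<Rightarrow> 'c \<Rightarrow> ('r, 'c) fm set \<Rightarrow> ('r, 'c) fm set \<Rightarrow> ('r, 'c) fm \<Rightarrow> bool" where
  "yields ar c0 S H X \<longleftrightarrow>
     (\<forall>M ov. standard_structure ar c0 S M \<longrightarrow> override_function c0 S ov \<longrightarrow>
        (\<forall>Y\<in>H. sat M ov Y) \<longrightarrow> sat M ov X)"

end

theory Submission
  imports Defs
begin

text \<open>A derivation may pass through formulas whose parameters lie outside
  \<open>P = pars_star c0 (H \<union> {Q})\<close>. Send every such parameter to a constant of \<open>P\<close>, which exists by the
  choice of \<open>P\<close>. Constants are never captured, so this renaming commutes with substitution, and it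
  fixes the formulas of \<open>H \<union> {Q}\<close>. By induction on the derivation the renamed formulas are all
  satisfied: the rules respect \<open>sat\<close> whatever values the override function takes, so it does not
  matter that they may leave the closure.\<close>

text \<open>Under a quantifier \<open>f\<close> is reset at the bound variable, so bound occurrences
  stay. Constants are renamed as well as variables, since both can lie outside the universe.\<close>

primrec map_params :: "('c trm \<Rightarrow> 'c trm) \<Rightarrow> ('r, 'c) fm \<Rightarrow> ('r, 'c) fm" where
  "map_params f Top = Top"
| "map_params f Bot = Bot"
| "map_params f (Rel R ts) = Rel R (map f ts)"
| "map_params f (Conj A B) = Conj (map_params f A) (map_params f B)"
| "map_params f (Disj A B) = Disj (map_params f A) (map_params f B)"
| "map_params f (Imp A B) = Imp (map_params f A) (map_params f B)"
| "map_params f (All x A) = All x (map_params (f(Var x := Var x)) A)"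
| "map_params f (Ex x A) = Ex x (map_params (f(Var x := Var x)) A)"

text \<open>A term that changes becomes a constant, so renaming never creates an occurrence of a
  variable.\<close>

definition fixes_or_const :: "('c trm \<Rightarrow> 'c trm) \<Rightarrow> bool" where
  "fixes_or_const f \<longleftrightarrow> (\<forall>s. f s = s \<or> (\<exists>c. f s = Con c))"

lemma fixes_or_const_upd [simp]: "fixes_or_const f \<Longrightarrow> fixes_or_const (f(Var x := Var x))"
  by (simp add: fixes_or_const_def)

lemma fixes_or_const_VarD: "fixes_or_const f \<Longrightarrow> f s = Var x \<Longrightarrow> s = Var x"
  unfolding fixes_or_const_def by (metis trm.distinct(1))

lemma map_params_cong:
  "(\<And>s. s \<in> params A \<Longrightarrow> f s = g s) \<Longrightarrow> map_params f A = map_params g A"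
proof (induction A arbitrary: f g)
  case (Rel R ts)
  have "s \<in> params (Rel R ts)" if "s \<in> set ts" for s
    using that by (induction s) (simp_all add: params_def)
  with Rel show ?case by simp
next
  case (Conj A B)
  have "map_params f A = map_params g A" "map_params f B = map_params g B"
    by (rule Conj.IH, rule Conj.prems, auto simp: params_def)+
  then show ?case by simp
next
  case (Disj A B)
  have "map_params f A = map_params g A" "map_params f B = map_params g B"
    by (rule Disj.IH, rule Disj.prems, auto simp: params_def)+
  then show ?case by simp
next
  case (Imp A B)
  have "map_params f A = map_params g A" "map_params f B = map_params g B"
    by (rule Imp.IH, rule Imp.prems, auto simp: params_def)+
  then show ?case by simp
next
  case (All x A)
  have "map_params (f(Var x := Var x)) A = map_params (g(Var x := Var x)) A"
  proof (rule All.IH)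
    show "(f(Var x := Var x)) s = (g(Var x := Var x)) s" if "s \<in> params A" for s
      using that All.prems[of s] by (auto simp: params_def)
  qed
  then show ?case by simp
next
  case (Ex x A)
  have "map_params (f(Var x := Var x)) A = map_params (g(Var x := Var x)) A"
  proof (rule Ex.IH)
    show "(f(Var x := Var x)) s = (g(Var x := Var x)) s" if "s \<in> params A" for s
      using that Ex.prems[of s] by (auto simp: params_def)
  qed
  then show ?case by simp
qed simp_all

lemma map_params_id: "map_params (\<lambda>s. s) A = A"
  by (induction A) (simp_all add: fun_upd_idem)

lemma map_params_upd_notin_fv:
  "x \<notin> fv A \<Longrightarrow> map_params (f(Var x := Var x)) A = map_params f A"
  by (rule map_params_cong) (auto simp: params_def)

text \<open>Fixing \<open>Var x\<close> keeps the free occurrences of \<open>x\<close>, and by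
  \<open>fixes_or_const\<close> no other term turns into \<open>x\<close>. So a renamed quantifier
  is vacuous exactly when the original is.\<close>

lemma in_fv_map_params_iff:
  "fixes_or_const f \<Longrightarrow> f (Var x) = Var x \<Longrightarrow> x \<in> fv (map_params f A) \<longleftrightarrow> x \<in> fv A"
proof (induction A arbitrary: f)
  case (Rel R ts)
  then show ?case
    by (metis (mono_tags, lifting) fixes_or_const_VarD fv.simps(3) image_iff list.set_map
        map_params.simps(3) mem_Collect_eq)
qed auto

lemma notin_fv_map_params: "fixes_or_const f \<Longrightarrow> x \<notin> fv A \<Longrightarrow> x \<notin> fv (map_params f A)"
  \<comment> \<open>Since \<open>x\<close> is not free in \<open>A\<close>, resetting
    \<open>f\<close> at \<open>x\<close> changes nothing and makes the equivalence
    applicable.\<close>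
  using in_fv_map_params_iff[of "f(Var x := Var x)" x A] by (simp add: map_params_upd_notin_fv)

lemma subst_notin_fv: "x \<notin> fv A \<Longrightarrow> subst x t A = A"
  by (induction A) (auto intro: map_idI)

lemma substable_map_params:
  "fixes_or_const f \<Longrightarrow> f (Var x) = Var x \<Longrightarrow> substable x t A \<Longrightarrow> t' = t \<or> (\<exists>c. t' = Con c)
    \<Longrightarrow> substable x t' (map_params f A)"
  by (induction A arbitrary: f) (auto simp: in_fv_map_params_iff)

text \<open>The reset on the right protects the occurrences of \<open>x\<close> until
  \<open>f t\<close> takes their place.\<close>

lemma map_params_subst:
  "fixes_or_const f \<Longrightarrow> substable x t A
    \<Longrightarrow> map_params f (subst x t A) = subst x (f t) (map_params (f(Var x := Var x)) A)"
proof (induction A arbitrary: f)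
  case (Rel R ts)
  then show ?case by (auto dest: fixes_or_const_VarD)
next
  case (All y A)
  show ?case
  proof (cases "x \<in> fv (All y A)")
    case True
    with All.prems have "y \<noteq> x" "t \<noteq> Var y" "substable x t A" by auto
    \<comment> \<open>As \<open>t\<close> is not \<open>Var y\<close>, the reset at \<open>y\<close>
      leaves \<open>f t\<close> alone; as \<open>y\<close> is not \<open>x\<close>, the two resets
      commute.\<close>
    with All.IH[of "f(Var y := Var y)"] All.prems(1) show ?thesis
      by (simp add: fun_upd_twist[of "Var x" "Var y"] del: fun_upd_apply)
        (simp add: fun_upd_def)
  next
    case False
    with notin_fv_map_params[OF All.prems(1) False] show ?thesis
      by (simp only: map_params_upd_notin_fv subst_notin_fv not_False_eq_True)
  qed
next
  case (Ex y A)
  show ?case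
  proof (cases "x \<in> fv (Ex y A)")
    case True
    with Ex.prems have "y \<noteq> x" "t \<noteq> Var y" "substable x t A" by auto
    with Ex.IH[of "f(Var y := Var y)"] Ex.prems(1) show ?thesis
      by (simp add: fun_upd_twist[of "Var x" "Var y"] del: fun_upd_apply)
        (simp add: fun_upd_def)
  next
    case False
    with notin_fv_map_params[OF Ex.prems(1) False] show ?thesis
      by (simp only: map_params_upd_notin_fv subst_notin_fv not_False_eq_True)
  qed
qed auto

text \<open>Distinct formulas may get equal images, which moves \<open>Disj\<close> and
  \<open>Imp\<close> to the clauses of \<open>sat\<close> for equal components; the rules are sound
  there too. The condition on \<open>range f\<close> puts each instance \<open>f t\<close> into the
  universe.\<close>

lemma QPL_sat_map_params:
  assumes f: "fixes_or_const f" "range f \<subseteq> univ M"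
    and hyps: "\<And>A. A \<in> H \<Longrightarrow> sat M ov (map_params f A)"
    and "QPL ar H Q"
  shows "sat M ov (map_params f Q)"
  using assms(4)
proof induction
  case (impE A B)
  then show ?case by (auto split: if_splits)
next
  case (allI A x)
  with f show ?case by (simp add: notin_fv_map_params map_params_upd_notin_fv)
next
  case (allE x A t)
  let ?A = "map_params (f(Var x := Var x)) A"
  have "substable x (f t) ?A"
    using f(1) allE.hyps(2) by (intro substable_map_params) (auto simp: fixes_or_const_def)
  moreover have "f t \<in> univ M" using f(2) by auto
  \<comment> \<open>If \<open>x\<close> is not free in \<open>?A\<close>, the vacuous clause applies
    and the substitution does nothing; otherwise instantiate at \<open>f t\<close>.\<close>
  ultimately have "sat M ov (subst x (f t) ?A)"
    using allE.IH by (auto simp: subst_notin_fv split: if_splits)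
  with f(1) allE.hyps(2) show ?case by (simp add: map_params_subst)
next
  case (exI x t A)
  let ?A = "map_params (f(Var x := Var x)) A"
  have "substable x (f t) ?A"
    using f(1) exI.hyps(2) by (intro substable_map_params) (auto simp: fixes_or_const_def)
  moreover have "f t \<in> univ M" using f(2) by auto
  moreover have "sat M ov (subst x (f t) ?A)"
    using exI.IH f(1) exI.hyps(2) by (simp add: map_params_subst)
  ultimately show ?case by (auto simp: subst_notin_fv)
next
  case (exE x A)
  with f show ?case by (simp add: notin_fv_map_params map_params_upd_notin_fv)
qed (auto simp: hyps)

lemma const_in_pars_star: "\<exists>c. Con c \<in> pars_star c0 S"
  by (auto simp: pars_star_def Let_def)

lemma params_subset_pars_star: "A \<in> S \<Longrightarrow> params A \<subseteq> pars_star c0 S"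
  by (auto simp: pars_star_def Let_def)

theorem theorem7p3:
  fixes ar :: "'r \<Rightarrow> nat" and c0 :: 'c
    and H :: "('r, 'c) fm set" and Q :: "('r, 'c) fm"
  assumes "\<And>A. A \<in> H \<Longrightarrow> is_formula ar A"
    and "is_formula ar Q"
    and "QPL ar H Q"
  shows "yields ar c0 (H \<union> {Q}) H Q"
  unfolding yields_def
proof (intro HOL.allI HOL.impI)
  fix M :: "('r, 'c) struct" and ov
  let ?P = "pars_star c0 (H \<union> {Q})"
  assume M: "standard_structure ar c0 (H \<union> {Q}) M" and H: "\<forall>Y\<in>H. sat M ov Y"
  obtain c where c: "Con c \<in> ?P" using const_in_pars_star[of c0 "H \<union> {Q}"] by auto
  \<comment> \<open>The target is a constant, not just any element of \<open>?P\<close>, to secure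
    \<open>fixes_or_const f\<close>.\<close>
  define f where "f s = (if s \<in> ?P then s else Con c)" for s
  have f_id: "map_params f A = A" if "A \<in> H \<union> {Q}" for A
  proof -
    have "map_params f A = map_params (\<lambda>s. s) A"
      using params_subset_pars_star[OF that, of c0] by (intro map_params_cong) (auto simp: f_def)
    then show ?thesis by (simp add: map_params_id)
  qed
  have "sat M ov (map_params f Q)"
  proof (rule QPL_sat_map_params[OF _ _ _ assms(3)])
    show "fixes_or_const f" by (simp add: fixes_or_const_def f_def)
    show "range f \<subseteq> univ M" using M c by (auto simp: standard_structure_def f_def)
    show "sat M ov (map_params f A)" if "A \<in> H" for A using that H f_id by simp
  qed
  then show "sat M ov Q" using f_id by simp
qed

end
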